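(* Let $\{W_1,\ldots,W_f\}$ be a set of mutually quasi-unbiased weighing matrices for parameters $(d,2,4,1)$. Then $f\leq d-1$.
   Context: A weighing matrix of order $d$ and weight $k$ is a $d\times d$ matrix $W$ with entries in $\{0,\pm1\}$ with $WW^T=kI$. Two weighing matrices $W_1,W_2$ of order $d$ and weight $k$ are quasi-unbiased for parameters $(d,k,l,a)$ if $\frac{1}{\sqrt a}W_1W_2^T$ is a weighing matrix of weight $l$. A set is mutually quasi-unbiased for $(d,k,l,a)$ if any two distinct members are quasi-unbiased for $(d,k,l,a)$. *)

theory Defs
  imports "HOL-Analysis.Analysis"
begin

text \<open>The order of a square matrix of type \<open>real^'d^'d\<close> is \<open>CARD('d)\<close>, which is at least 1.\<close>

definition weighing_matrix :: "nat \<Rightarrow> real^'d^'d \<Rightarrow> bool" where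
  "weighing_matrix k W \<longleftrightarrow>
     (\<forall>i j. W $ i $ j \<in> {0, 1, -1}) \<and> W ** transpose W = real k *\<^sub>R mat 1"

definition quasi_unbiased :: "nat \<Rightarrow> nat \<Rightarrow> nat \<Rightarrow> real^'d^'d \<Rightarrow> real^'d^'d \<Rightarrow> bool" where
  "quasi_unbiased k l a W\<^sub>1 W\<^sub>2 \<longleftrightarrow>
     weighing_matrix k W\<^sub>1 \<and> weighing_matrix k W\<^sub>2 \<and>
     weighing_matrix l ((1 / sqrt (real a)) *\<^sub>R (W\<^sub>1 ** transpose W\<^sub>2))"

text \<open>The first conjunct only matters for singletons, where there are no two distinct members.\<close>

definition mutually_quasi_unbiased :: "nat \<Rightarrow> nat \<Rightarrow> nat \<Rightarrow> (real^'d^'d) set \<Rightarrow> bool" where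
  "mutually_quasi_unbiased k l a S \<longleftrightarrow>
     (\<forall>W\<in>S. weighing_matrix k W) \<and>
     (\<forall>W\<^sub>1\<in>S. \<forall>W\<^sub>2\<in>S. W\<^sub>1 \<noteq> W\<^sub>2 \<longrightarrow> quasi_unbiased k l a W\<^sub>1 W\<^sub>2)"

end

theory Submission
  imports Defs
begin

text \<open>
  In a weighing matrix of weight 2, two rows whose supports meet have the same support, so the
  supports of the rows form a perfect matching of the columns, each edge \<open>{c, p}\<close> carrying, up to
  sign, the two rows \<open>e\<^sub>c + e\<^sub>p\<close> and \<open>e\<^sub>c - e\<^sub>p\<close>. If the matchings of two members share the edge
  \<open>{c, p}\<close>, then both contain a row \<open>\<plusminus>(e\<^sub>c + e\<^sub>p)\<close>, and the inner product \<open>\<plusminus>2\<close> of these is not an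
  admissible entry. Hence for a fixed column \<open>c\<close> the partners of \<open>c\<close> are pairwise distinct.
\<close>

lemma weighing_matrix_entry:
  assumes "weighing_matrix k W"
  shows "W $ i $ j = 0 \<or> W $ i $ j = 1 \<or> W $ i $ j = -1"
  using assms by (auto simp: weighing_matrix_def)

lemma weighing_matrix_rows:
  fixes W :: "real^'d^'d"
  assumes "weighing_matrix k W"
  shows "(\<Sum>m\<in>UNIV. W $ i $ m * W $ j $ m) = (if i = j then real k else 0)"
proof -
  have "(W ** transpose W) $ i $ j = (real k *\<^sub>R mat 1 :: real^'d^'d) $ i $ j"
    using assms by (simp add: weighing_matrix_def)
  then show ?thesis
    by (simp add: matrix_matrix_mult_def transpose_def mat_def split: if_splits)
qed

text \<open>For \<open>k > 0\<close>, \<open>transpose W\<close> divided by \<open>k\<close> is a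
  right inverse of \<open>W\<close>, and a right inverse of a square matrix is also a left inverse.
  This makes the inner products of columns available.\<close>

lemma weighing_matrix_transpose:
  fixes W :: "real^'d^'d"
  assumes "weighing_matrix k W" and "k > 0"
  shows "weighing_matrix k (transpose W)"
proof -
  have "W ** transpose W = real k *\<^sub>R mat 1"
    using assms(1) by (simp add: weighing_matrix_def)
  then have "W ** ((1 / real k) *\<^sub>R transpose W) = mat 1"
    using assms(2) by (simp add: matrix_scalar_ac flip: scalar_matrix_assoc)
  then have "((1 / real k) *\<^sub>R transpose W) ** W = mat 1"
    by (simp add: matrix_left_right_inverse)
  then have "real k *\<^sub>R ((1 / real k) *\<^sub>R (transpose W ** W)) = real k *\<^sub>R mat 1"
    by (simp add: scalar_matrix_assoc)
  then have "transpose W ** W = real k *\<^sub>R mat 1"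
    using assms(2) by simp
  then show ?thesis
    using assms(1) by (simp add: weighing_matrix_def) (simp add: transpose_def)
qed

lemma weighing_matrix_columns:
  fixes W :: "real^'d^'d"
  assumes "weighing_matrix k W" and "k > 0"
  shows "(\<Sum>m\<in>UNIV. W $ m $ i * W $ m $ j) = (if i = j then real k else 0)"
  using weighing_matrix_rows[OF weighing_matrix_transpose[OF assms], of i j]
  by (simp add: transpose_def)

text \<open>The product 1 encodes equal nonzero signs at \<open>c\<close> and \<open>p\<close>. A
  row meeting \<open>c\<close> has a second nonzero entry, at some \<open>p\<close>; if its signs
  there differ, orthogonality of columns \<open>c\<close> and \<open>p\<close> forces another row in
  which they agree.\<close>

lemma weight_2_partner_exists:
  fixes W :: "real^'d^'d" and c :: 'd
  assumes W: "weighing_matrix 2 W"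
  shows "\<exists>p. p \<noteq> c \<and> (\<exists>r. W $ r $ c * W $ r $ p = 1)"
proof -
  note entry = weighing_matrix_entry[OF W]
  have "(\<Sum>m\<in>UNIV. W $ m $ c * W $ m $ c) = 2"
    using weighing_matrix_columns[OF W, of c c] by simp
  then obtain r where r: "W $ r $ c \<noteq> 0"
    by (metis (no_types, lifting) mult_zero_left sum.neutral zero_neq_numeral)
  have "(\<Sum>m\<in>UNIV. W $ r $ m * W $ r $ m) = 2"
    using weighing_matrix_rows[OF W, of r r] by simp
  then have "W $ r $ c * W $ r $ c + (\<Sum>m\<in>UNIV - {c}. W $ r $ m * W $ r $ m) = 2"
    by (simp add: sum.remove[of UNIV c])
  moreover have "W $ r $ c * W $ r $ c = 1"
    using entry[of r c] r by auto
  ultimately have "(\<Sum>m\<in>UNIV - {c}. W $ r $ m * W $ r $ m) \<noteq> 0"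
    by simp
  then obtain p where p: "p \<noteq> c" "W $ r $ p \<noteq> 0"
    by (metis (no_types, lifting) DiffD2 insertI1 mult_zero_left sum.neutral)
  have "\<exists>s. W $ s $ c * W $ s $ p = 1"
  proof (rule ccontr)
    assume none: "\<not> ?thesis"
    have le: "W $ s $ c * W $ s $ p \<le> 0" for s
      using none entry[of s c] entry[of s p] by (auto dest: spec[of _ s])
    \<comment> \<open>Row \<open>r\<close> makes the inner product of the two columns strictly
      negative, since no row contributes a positive term.\<close>
    have "W $ r $ c * W $ r $ p < 0"
      using le[of r] r p by (simp add: order_less_le)
    then have "(\<Sum>s\<in>UNIV. W $ s $ c * W $ s $ p) < (\<Sum>s\<in>(UNIV :: 'd set). 0)"
      using le by (intro sum_strict_mono_ex1) auto
    then show False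
      using weighing_matrix_columns[OF W, of c p] p by simp
  qed
  with p show ?thesis by blast
qed

text \<open>The entries at \<open>c\<close> and \<open>p\<close> are both nonzero, so they already
  exhaust the squared norm 2 of the row.\<close>

lemma weight_2_row_support:
  fixes W :: "real^'d^'d"
  assumes W: "weighing_matrix 2 W" and "p \<noteq> c" and cp: "W $ r $ c * W $ r $ p = 1"
    and "m \<noteq> c" and "m \<noteq> p"
  shows "W $ r $ m = 0"
proof -
  have "(\<Sum>n\<in>{c, p, m}. W $ r $ n * W $ r $ n) \<le> (\<Sum>n\<in>UNIV. W $ r $ n * W $ r $ n)"
    by (intro sum_mono2) auto
  also have "\<dots> = 2"
    using weighing_matrix_rows[OF W, of r r] by simp
  finally have "W $ r $ c * W $ r $ c + W $ r $ p * W $ r $ p + W $ r $ m * W $ r $ m \<le> 2"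
    using assms by (simp add: add.assoc)
  then show ?thesis
    using weighing_matrix_entry[OF W, of r c] weighing_matrix_entry[OF W, of r p]
      weighing_matrix_entry[OF W, of r m] cp by auto
qed

lemma quasi_unbiased_no_common_partner:
  fixes V W :: "real^'d^'d"
  assumes VW: "quasi_unbiased 2 4 1 V W" and "p \<noteq> c"
    and r: "V $ r $ c * V $ r $ p = 1" and s: "W $ s $ c * W $ s $ p = 1"
  shows False
proof -
  have V: "weighing_matrix 2 V" and W: "weighing_matrix 2 W"
    and P: "weighing_matrix 4 (V ** transpose W)"
    using VW by (simp_all add: quasi_unbiased_def)
  have "(V ** transpose W) $ r $ s = (\<Sum>m\<in>UNIV. V $ r $ m * W $ s $ m)"
    by (simp add: matrix_matrix_mult_def transpose_def)
  also have "\<dots> = (\<Sum>m\<in>{c, p}. V $ r $ m * W $ s $ m)"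
    using weight_2_row_support[OF V \<open>p \<noteq> c\<close> r] by (intro sum.mono_neutral_right) auto
  also have "\<dots> = V $ r $ c * W $ s $ c + V $ r $ p * W $ s $ p"
    using \<open>p \<noteq> c\<close> by simp
  \<comment> \<open>By \<open>r\<close> and \<open>s\<close> each row has equal nonzero entries at
    \<open>c\<close> and \<open>p\<close>, so the two summands coincide and the sum is 2 or
    -2.\<close>
  finally show False
    using weighing_matrix_entry[OF P, of r s]
      weighing_matrix_entry[OF V, of r c] weighing_matrix_entry[OF V, of r p]
      weighing_matrix_entry[OF W, of s c] weighing_matrix_entry[OF W, of s p] r s
    by auto
qed

theorem theorem5p1:
  fixes S :: "(real^'d^'d) set" and f :: nat
  assumes "finite S" and "card S = f"
    and "mutually_quasi_unbiased 2 4 1 S"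
  shows "f \<le> CARD('d) - 1"
proof -
  \<comment> \<open>Any column serves: the choice \<open>p\<close> of partners maps \<open>S\<close>
    injectively into the remaining columns.\<close>
  fix c :: 'd
  have "\<forall>W\<in>S. \<exists>p. p \<noteq> c \<and> (\<exists>r. W $ r $ c * W $ r $ p = 1)"
    using assms(3) weight_2_partner_exists unfolding mutually_quasi_unbiased_def by blast
  then obtain p where p: "\<And>W. W \<in> S \<Longrightarrow> p W \<noteq> c \<and> (\<exists>r. W $ r $ c * W $ r $ p W = 1)"
    by metis
  have "inj_on p S"
  proof (rule inj_onI, rule ccontr)
    fix V W
    assume VW: "V \<in> S" "W \<in> S" "p V = p W" "V \<noteq> W"
    then have "quasi_unbiased 2 4 1 V W"
      using assms(3) by (simp add: mutually_quasi_unbiased_def)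
    then show False
      using p[of V] p[of W] VW quasi_unbiased_no_common_partner by metis
  qed
  moreover have "p ` S \<subseteq> UNIV - {c}"
    using p by auto
  ultimately have "card S \<le> card (UNIV - {c})"
    by (intro card_inj_on_le) auto
  then show ?thesis
    using assms(2) by simp
qed

end
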